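(* Assume $\mathcal{D}\cap\mathcal{T}=\emptyset$ and that input and output sets satisfy $\mathcal{D}\cap\mathcal{B}=\emptyset$ and $\mathcal{T}\cap\mathcal{C}=\emptyset$. Let $\mathcal{P}$ be the union of (the node sets of) all $\mathcal{D}$-to-$\mathcal{T}$ paths. Then: (a) if $\mathcal{B},\mathcal{C}$ are a feasible solution of Problem 2B, with associated set $\mathcal{W}$, then $\mathcal{B}\supseteq\partial_+(\mathcal{W},A)$ and $\mathcal{C}\supseteq\partial_-(\mathcal{W},A)$; (b) if $\mathcal{B},\mathcal{C}$ are an optimal solution of Problem 2B, with associated set $\mathcal{W}$, then $\mathcal{B}=\partial_+(\mathcal{W},A)\cap\mathcal{P}=\partial_+(\mathcal{W},A)$ and $\mathcal{C}=\partial_-(\mathcal{W},A)\cap\mathcal{P}=\partial_-(\mathcal{W},A)$; (c) $\mathcal{B},\mathcal{C}$ are an optimal solution of Problem 2B if and only if they are of minimal cardinality (i.e. with $|\mathcal{B}|+|\mathcal{C}|$ minimal) among the sets of nodes for which, for an associated set $\mathcal{W}$, $\mathcal{B}=\partial_+(\mathcal{W},A)\cap\mathcal{P}=\partial_+(\mathcal{W},A)$ and $\mathcal{C}=\partial_-(\mathcal{W},A)\cap\mathcal{P}=\partial_-(\mathcal{W},A)$.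
   Context: Let $(\mathcal{V},\mathcal{E},A)$ be a digraph with $\mathcal{V}=\{v_1,\dots,v_n\}$, where $(v_i,v_j)\in\mathcal{E}$ means $v_i\to v_j$, and $A\in\mathbb{R}^{n\times n}$ has $A_{ji}\ne0$ if and only if $(v_i,v_j)\in\mathcal{E}$. $\mathcal{D},\mathcal{T}\subset\mathcal{V}$ are given sets of disturbance and target nodes; $\mathcal{B},\mathcal{C}\subseteq\mathcal{V}$ are the sets of input and output nodes to be chosen. $B$ is the matrix whose columns are the canonical vectors $e_i$ with $v_i\in\mathcal{B}$ and $C$ the matrix whose rows are the $e_i^\top$ with $v_i\in\mathcal{C}$. Node sets are identified with the subspaces of $\mathbb{R}^n$ spanned by the corresponding canonical vectors. $\mathcal{W}$ is $(A,B)$-invariant if $A\mathcal{W}\subseteq\mathcal{W}+\mathcal{B}$, and $(C,A)$-invariant if $A(\mathcal{W}\setminus\mathcal{C})\subseteq\mathcal{W}$. Problem 2B: minimize $|\mathcal{B}|+|\mathcal{C}|$ over $\mathcal{B},\mathcal{C}$ subject to the existence of a set of nodes $\mathcal{W}$ that is both $(A,B)$-invariant and $(C,A)$-invariant and satisfies $\mathcal{D}\subseteq\mathcal{W}\subseteq\mathcal{V}\setminus\mathcal{T}$. A pair $\mathcal{B},\mathcal{C}$ is feasible if such a $\mathcal{W}$ exists (any such $\mathcal{W}$ is called an associated set of $\mathcal{B},\mathcal{C}$), and optimal if it is feasible with $|\mathcal{B}|+|\mathcal{C}|$ minimal. In-boundary: $\partial_-(\mathcal{W},A)=\{v_i\in\mathcal{W}:\exists\,(v_i,v_j)\in\mathcal{E},\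 v_j\notin\mathcal{W}\}$. Out-boundary: $\partial_+(\mathcal{W},A)=\{v_j\notin\mathcal{W}:\exists\,(v_i,v_j)\in\mathcal{E},\ v_i\in\mathcal{W}\}$. A $\mathcal{D}$-to-$\mathcal{T}$ path is a sequence of distinct nodes, the first in $\mathcal{D}$ and the last in $\mathcal{T}$, in which each consecutive pair is an edge. *)

theory Defs
  imports "HOL-Analysis.Analysis"
begin

text \<open>
  The node set is the finite index type \<open>'n\<close>; node \<open>i\<close> is identified with the
  canonical vector \<open>axis i 1\<close>, and a set of nodes with the subspace
  \<open>node_space W\<close>. In \<open>A $ j $ i\<close> the first index is the row, so the edge
  \<open>i \<rightarrow> j\<close> corresponds to \<open>A $ j $ i \<noteq> 0\<close>.
\<close>

definition node_space :: "'n::finite set \<Rightarrow> (real^'n) set" where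
  "node_space W = span ((\<lambda>i. axis i 1) ` W)"

text \<open>The \<open>+\<close> below is the elementwise sum of two subspaces.\<close>

definition AB_invariant :: "real^'n^'n \<Rightarrow> 'n::finite set \<Rightarrow> 'n set \<Rightarrow> bool" where
  "AB_invariant A B W \<longleftrightarrow> (\<lambda>x. A *v x) ` node_space W \<subseteq> node_space W + node_space B"

text \<open>
  The difference \<open>W - C\<close> is taken between node sets, before passing to the
  spanned subspace; \<open>node_space (W - C)\<close> is the intersection of
  \<open>node_space W\<close> with the kernel of the output matrix of \<open>C\<close>.
\<close>

definition CA_invariant :: "real^'n^'n \<Rightarrow> 'n::finite set \<Rightarrow> 'n set \<Rightarrow> bool" where
  "CA_invariant A C W \<longleftrightarrow> (\<lambda>x. A *v x) ` node_space (W - C) \<subseteq> node_space W"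

definition associated_set ::
  "real^'n^'n \<Rightarrow> 'n::finite set \<Rightarrow> 'n set \<Rightarrow> 'n set \<Rightarrow> 'n set \<Rightarrow> 'n set \<Rightarrow> bool" where
  "associated_set A D T B C W \<longleftrightarrow>
     AB_invariant A B W \<and> CA_invariant A C W \<and> D \<subseteq> W \<and> W \<subseteq> UNIV - T"

text \<open>
  The standing restrictions on the input and output sets: they apply to every
  pair over which the problem is posed, hence also to the competitors in the
  definition of optimality.
\<close>

definition admissible :: "'n set \<Rightarrow> 'n set \<Rightarrow> 'n set \<Rightarrow> 'n set \<Rightarrow> bool" where
  "admissible D T B C \<longleftrightarrow> D \<inter> B = {} \<and> T \<inter> C = {}"

definition feasible ::
  "real^'n^'n \<Rightarrow> 'n::finite set \<Rightarrow> 'n set \<Rightarrow> 'n set \<Rightarrow> 'n set \<Rightarrow> bool" where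
  "feasible A D T B C \<longleftrightarrow> admissible D T B C \<and> (\<exists>W. associated_set A D T B C W)"

definition optimal ::
  "real^'n^'n \<Rightarrow> 'n::finite set \<Rightarrow> 'n set \<Rightarrow> 'n set \<Rightarrow> 'n set \<Rightarrow> bool" where
  "optimal A D T B C \<longleftrightarrow>
     is_arg_min (\<lambda>(B, C). card B + card C) (\<lambda>(B, C). feasible A D T B C) (B, C)"

definition in_boundary :: "('n \<times> 'n) set \<Rightarrow> 'n set \<Rightarrow> 'n set" where
  "in_boundary E W = {i \<in> W. \<exists>j. (i, j) \<in> E \<and> j \<notin> W}"

definition out_boundary :: "('n \<times> 'n) set \<Rightarrow> 'n set \<Rightarrow> 'n set" where
  "out_boundary E W = {j. j \<notin> W \<and> (\<exists>i. (i, j) \<in> E \<and> i \<in> W)}"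

definition is_path :: "('n \<times> 'n) set \<Rightarrow> 'n set \<Rightarrow> 'n set \<Rightarrow> 'n list \<Rightarrow> bool" where
  "is_path E D T p \<longleftrightarrow>
     p \<noteq> [] \<and> distinct p \<and> hd p \<in> D \<and> last p \<in> T \<and> successively (\<lambda>i j. (i, j) \<in> E) p"

definition path_nodes :: "('n \<times> 'n) set \<Rightarrow> 'n set \<Rightarrow> 'n set \<Rightarrow> 'n set" where
  "path_nodes E D T = (\<Union>p \<in> {p. is_path E D T p}. set p)"

end

theory Submission
  imports Defs "HOL-Library.Transitive_Closure_Table"
begin

text \<open>
  Invariance is a condition on edges. The map \<open>A\<close> sends the coordinate subspace of \<open>U\<close> into
  that of \<open>V\<close> iff every edge leaving a node of \<open>U\<close> ends in \<open>V\<close>. Hence \<open>W\<close> is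
  \<open>(A,B)\<close>-invariant iff \<open>B\<close> contains the out-boundary of \<open>W\<close>, and \<open>(C,A)\<close>-invariant iff \<open>C\<close>
  contains its in-boundary. This is part (a), and it turns the problem into the minimization,
  over node sets \<open>W\<close> that separate \<open>D\<close> from \<open>T\<close> (contain \<open>D\<close> and avoid \<open>T\<close>), of the sum of
  the cardinalities of the two boundaries:
  the best pair for a given \<open>W\<close> is the pair of its boundaries, which is admissible because
  \<open>D \<subseteq> W\<close> and \<open>W\<close> avoids \<open>T\<close>.

  It remains to see that boundary nodes off the \<open>D\<close>-to-\<open>T\<close> paths are wasteful. Given a
  separating \<open>W\<close>, delete the edges that leave \<open>W\<close> and have both end points on
  \<open>D\<close>-to-\<open>T\<close> paths, and let \<open>W'\<close> be the set of nodes still reachable from \<open>D\<close>. If \<open>W'\<close> met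
  \<open>T\<close>, a repetition-free surviving path from \<open>D\<close> to \<open>T\<close> would have to leave \<open>W\<close> along some edge;
  as this edge lies on that very path, it was deleted. So \<open>W'\<close> separates too, and every edge
  leaving \<open>W'\<close> is a deleted one: the boundaries of \<open>W'\<close> consist of boundary nodes of \<open>W\<close> lying
  on paths (\<open>exists_separator_with_boundaries_on_paths\<close>).

  For an optimal pair all inclusions between \<open>B\<close>, \<open>C\<close>, the boundaries of \<open>W\<close> and those of \<open>W'\<close>
  are then equalities, which is part (b). Part (c) follows because replacing \<open>W\<close> by \<open>W'\<close> turns
  every feasible pair into a boundary pair that is no larger.
\<close>

section \<open>Invariance as a condition on edges\<close>

lemma node_space_eq: "node_space W = {x :: real^'n::finite. \<forall>i. i \<notin> W \<longrightarrow> x $ i = 0}"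
proof
  have "subspace {x :: real^'n. \<forall>i. i \<notin> W \<longrightarrow> x $ i = 0}"
    by (simp add: subspace_def)
  then show "node_space W \<subseteq> {x :: real^'n. \<forall>i. i \<notin> W \<longrightarrow> x $ i = 0}"
    unfolding node_space_def by (rule span_minimal[rotated]) (auto simp: axis_def)
next
  show "{x :: real^'n. \<forall>i. i \<notin> W \<longrightarrow> x $ i = 0} \<subseteq> node_space W"
  proof
    fix x :: "real^'n" assume "x \<in> {x. \<forall>i. i \<notin> W \<longrightarrow> x $ i = 0}"
    then have "x $ i *\<^sub>R axis i 1 \<in> node_space W" for i
      by (cases "i \<in> W") (auto simp: node_space_def span_zero intro: span_scale span_base)
    then have "(\<Sum>i\<in>UNIV. x $ i *\<^sub>R axis i 1) \<in> node_space W"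
      unfolding node_space_def by (intro span_sum)
    then show "x \<in> node_space W"
      using basis_expansion[of x] by (simp add: scalar_mult_eq_scaleR)
  qed
qed

lemma node_space_plus: "node_space W + node_space B = node_space (W \<union> B)"
proof
  show "node_space W + node_space B \<subseteq> node_space (W \<union> B)"
    by (auto simp: node_space_eq elim!: set_plus_elim)
next
  show "node_space (W \<union> B) \<subseteq> node_space W + node_space B"
  proof
    fix x :: "real^'a" assume x: "x \<in> node_space (W \<union> B)"
    let ?y = "\<chi> i. if i \<in> W then x $ i else 0"
    have "?y \<in> node_space W" "x - ?y \<in> node_space B"
      using x by (auto simp: node_space_eq)
    then have "?y + (x - ?y) \<in> node_space W + node_space B"
      by (rule set_plus_intro)
    then show "x \<in> node_space W + node_space B" by simp
  qed
qed

lemma image_node_space_subset_iff: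
  fixes A :: "real^'n::finite^'n"
  shows "(\<lambda>x. A *v x) ` node_space U \<subseteq> node_space V \<longleftrightarrow>
    (\<forall>i\<in>U. \<forall>j. A $ j $ i \<noteq> 0 \<longrightarrow> j \<in> V)"
proof (intro iffI ballI allI impI)
  fix i j assume sub: "(\<lambda>x. A *v x) ` node_space U \<subseteq> node_space V"
    and "i \<in> U" and nz: "A $ j $ i \<noteq> 0"
  then have "axis i 1 \<in> node_space U" by (auto simp: node_space_def intro: span_base)
  with sub have "A *v axis i 1 \<in> node_space V" by blast
  with nz show "j \<in> V"
    by (auto simp: matrix_vector_mul_component inner_axis node_space_eq)
next
  assume edges: "\<forall>i\<in>U. \<forall>j. A $ j $ i \<noteq> 0 \<longrightarrow> j \<in> V"
  have "(A *v x) $ j = 0" if "x \<in> node_space U" "j \<notin> V" for x j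
  proof -
    have "A $ j $ i * x $ i = 0" for i
      using that edges by (cases "i \<in> U") (auto simp: node_space_eq)
    then have "(\<Sum>i\<in>UNIV. A $ j $ i * x $ i) = 0" by (intro sum.neutral) simp
    then show ?thesis by (simp add: matrix_vector_mult_def)
  qed
  then show "(\<lambda>x. A *v x) ` node_space U \<subseteq> node_space V"
    by (auto simp: node_space_eq[of V])
qed

lemma AB_invariant_iff_out_boundary:
  assumes "\<And>i j. A $ j $ i \<noteq> 0 \<longleftrightarrow> (i, j) \<in> E"
  shows "AB_invariant A B W \<longleftrightarrow> out_boundary E W \<subseteq> B"
  unfolding AB_invariant_def node_space_plus image_node_space_subset_iff assms out_boundary_def
  by blast

lemma CA_invariant_iff_in_boundary:
  assumes "\<And>i j. A $ j $ i \<noteq> 0 \<longleftrightarrow> (i, j) \<in> E"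
  shows "CA_invariant A C W \<longleftrightarrow> in_boundary E W \<subseteq> C"
  unfolding CA_invariant_def image_node_space_subset_iff assms in_boundary_def
  by blast

lemma associated_set_iff_boundaries:
  assumes "\<And>i j. A $ j $ i \<noteq> 0 \<longleftrightarrow> (i, j) \<in> E"
  shows "associated_set A D T B C W \<longleftrightarrow>
    out_boundary E W \<subseteq> B \<and> in_boundary E W \<subseteq> C \<and> D \<subseteq> W \<and> W \<inter> T = {}"
  unfolding associated_set_def
    AB_invariant_iff_out_boundary[OF assms] CA_invariant_iff_in_boundary[OF assms]
  by blast

section \<open>Moving the boundaries onto the paths\<close>

lemma rtrancl_path_imp_successively:
  "rtrancl_path r x xs y \<Longrightarrow> successively r (x # xs) \<and> last (x # xs) = y"
  by (induction rule: rtrancl_path.induct) (auto simp: successively_Cons)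

lemma reachable_imp_is_path:
  assumes "(d, t) \<in> E\<^sup>*" and "d \<in> D" and "t \<in> T"
  obtains p where "is_path E D T p"
proof -
  let ?r = "\<lambda>i j. (i, j) \<in> E"
  have "?r\<^sup>*\<^sup>* d t" using assms(1) by (simp add: rtranclp_rtrancl_eq)
  then obtain ys where "rtrancl_path ?r d ys t" unfolding rtranclp_eq_rtrancl_path by blast
  then obtain xs where "rtrancl_path ?r d xs t" "distinct (d # xs)"
    by (rule rtrancl_path_distinct)
  with rtrancl_path_imp_successively[of _ d xs t] assms(2,3) have "is_path E D T (d # xs)"
    by (auto simp: is_path_def)
  then show ?thesis by (rule that)
qed

lemma successively_exits:
  assumes "successively r p" and "p \<noteq> []" and "hd p \<in> W" and "last p \<notin> W"
  obtains u v where "r u v" "u \<in> set p" "v \<in> set p" "u \<in> W" "v \<notin> W"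
  using assms
proof (induction p arbitrary: thesis)
  case (Cons a p)
  show ?case
  proof (cases p)
    case (Cons b q)
    with Cons.prems have "r a b" "successively r p" "last p \<notin> W" "a \<in> W" by auto
    show ?thesis
    proof (cases "b \<in> W")
      case True
      then obtain u v where "r u v" "u \<in> set p" "v \<in> set p" "u \<in> W" "v \<notin> W"
        using Cons.IH \<open>successively r p\<close> \<open>last p \<notin> W\<close> \<open>p = b # q\<close> by auto
      then show ?thesis using Cons.prems(1)[of u v] by simp
    next
      case False
      then show ?thesis
        using Cons.prems(1)[of a b] \<open>r a b\<close> \<open>a \<in> W\<close> \<open>p = b # q\<close> by simp
    qed
  qed (use Cons.prems in auto)
qed simp

lemma is_path_mono: "is_path R D T p \<Longrightarrow> R \<subseteq> E \<Longrightarrow> is_path E D T p"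
  unfolding is_path_def by (auto intro: successively_mono)

text \<open>
  An edge leaving the new set must be one of the deleted edges, for otherwise its head would be
  reachable as well. Since these run from \<open>W\<close> to its complement between nodes on paths, both
  boundaries land where they should. Deleting only edges between such nodes suffices to cut
  \<open>D\<close> from \<open>T\<close>, since the edge along which a path leaves \<open>W\<close> is always one of them.
\<close>

lemma exists_separator_with_boundaries_on_paths:
  assumes "D \<subseteq> W" and "W \<inter> T = {}"
  obtains W' where "D \<subseteq> W'" "W' \<inter> T = {}"
    "out_boundary E W' \<subseteq> out_boundary E W \<inter> path_nodes E D T"
    "in_boundary E W' \<subseteq> in_boundary E W \<inter> path_nodes E D T"
proof -
  let ?P = "path_nodes E D T"
  define R where "R = E - (W \<inter> ?P) \<times> (?P - W)"
  define W' where "W' = R\<^sup>* `` D"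
  have deleted: "u \<in> W \<inter> ?P \<and> v \<in> ?P - W" if "(u, v) \<in> E" "u \<in> W'" "v \<notin> W'" for u v
    using that by (auto simp: R_def W'_def intro: rtrancl.rtrancl_into_rtrancl)
  have "W' \<inter> T = {}"
  proof (rule ccontr)
    assume "W' \<inter> T \<noteq> {}"
    then obtain p where p: "is_path R D T p"
      unfolding W'_def by (blast elim: reachable_imp_is_path)
    then have "successively (\<lambda>i j. (i, j) \<in> R) p" "p \<noteq> []" "hd p \<in> W" "last p \<notin> W"
      using assms by (auto simp: is_path_def)
    then obtain u v where uv: "(u, v) \<in> R" "u \<in> set p" "v \<in> set p" "u \<in> W" "v \<notin> W"
      by (rule successively_exits)
    have "is_path E D T p" using p by (rule is_path_mono) (auto simp: R_def)
    with uv(2,3) have "u \<in> ?P" "v \<in> ?P" by (auto simp: path_nodes_def)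
    with uv show False by (simp add: R_def)
  qed
  moreover have "D \<subseteq> W'" by (auto simp: W'_def)
  moreover have "out_boundary E W' \<subseteq> out_boundary E W \<inter> ?P"
    using deleted unfolding out_boundary_def by blast
  moreover have "in_boundary E W' \<subseteq> in_boundary E W \<inter> ?P"
    using deleted unfolding in_boundary_def by blast
  ultimately show ?thesis using that by blast
qed

section \<open>Optimal pairs\<close>

lemma subset_pair_eq_if_card_sum_ge:
  assumes "finite B" "finite C" "B' \<subseteq> B" "C' \<subseteq> C" "\<not> card B' + card C' < card B + card C"
  shows "B' = B" "C' = C"
proof -
  have "card B' \<le> card B" "card C' \<le> card C" using assms by (auto intro: card_mono)
  then have "card B' = card B" "card C' = card C" using assms(5) by auto
  then show "B' = B" "C' = C"
    using assms card_subset_eq[of B B'] card_subset_eq[of C C'] by simp_all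
qed

theorem theorem7:
  fixes A :: "real^'n^'n" and E :: "('n::finite \<times> 'n) set" and D T P :: "'n set"
  assumes E: "\<And>i j. A $ j $ i \<noteq> 0 \<longleftrightarrow> (i, j) \<in> E"
    and DT: "D \<inter> T = {}"
    and P: "P = path_nodes E D T"
  shows
    "(\<forall>B C W. feasible A D T B C \<and> associated_set A D T B C W \<longrightarrow>
        out_boundary E W \<subseteq> B \<and> in_boundary E W \<subseteq> C)
   \<and> (\<forall>B C W. optimal A D T B C \<and> associated_set A D T B C W \<longrightarrow>
        B = out_boundary E W \<inter> P \<and> out_boundary E W \<inter> P = out_boundary E W \<and>
        C = in_boundary E W \<inter> P \<and> in_boundary E W \<inter> P = in_boundary E W)
   \<and> (\<forall>B C. optimal A D T B C \<longleftrightarrow>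
        is_arg_min (\<lambda>(B, C). card B + card C)
          (\<lambda>(B, C). admissible D T B C \<and>
             (\<exists>W. associated_set A D T B C W \<and>
                B = out_boundary E W \<inter> P \<and> out_boundary E W \<inter> P = out_boundary E W \<and>
                C = in_boundary E W \<inter> P \<and> in_boundary E W \<inter> P = in_boundary E W))
          (B, C))"
proof -
  note assoc = associated_set_iff_boundaries[OF E]
  define Q where "Q B C \<longleftrightarrow> admissible D T B C \<and>
    (\<exists>W. associated_set A D T B C W \<and>
      B = out_boundary E W \<inter> P \<and> out_boundary E W \<inter> P = out_boundary E W \<and>
      C = in_boundary E W \<inter> P \<and> in_boundary E W \<inter> P = in_boundary E W)" for B C
  have optimal_iff: "optimal A D T B C \<longleftrightarrow> feasible A D T B C \<and>
      (\<forall>B' C'. feasible A D T B' C' \<longrightarrow> \<not> card B' + card C' < card B + card C)" for B C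
    by (auto simp: optimal_def is_arg_min_def)
  have Q_feasible: "feasible A D T B C" if "Q B C" for B C
    using that unfolding Q_def feasible_def by blast
  have improve: "\<exists>B' C'. Q B' C' \<and> B' \<subseteq> out_boundary E W \<inter> P \<and> C' \<subseteq> in_boundary E W \<inter> P"
    if W: "associated_set A D T B C W" for B C W
  proof -
    obtain W' where W': "D \<subseteq> W'" "W' \<inter> T = {}"
      and sub: "out_boundary E W' \<subseteq> out_boundary E W \<inter> P"
        "in_boundary E W' \<subseteq> in_boundary E W \<inter> P"
      using W exists_separator_with_boundaries_on_paths[of D W T E] unfolding assoc P by blast
    have "admissible D T (out_boundary E W') (in_boundary E W')"
      using W' by (auto simp: admissible_def out_boundary_def in_boundary_def)
    moreover have "associated_set A D T (out_boundary E W') (in_boundary E W') W'"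
      using W' by (simp add: assoc)
    ultimately have "Q (out_boundary E W') (in_boundary E W')"
      unfolding Q_def using sub by blast
    with sub show ?thesis by blast
  qed
  have a: "out_boundary E W \<subseteq> B \<and> in_boundary E W \<subseteq> C"
    if "associated_set A D T B C W" for B C W
    using that by (simp add: assoc)
  have b: "B = out_boundary E W \<inter> P \<and> out_boundary E W \<inter> P = out_boundary E W \<and>
      C = in_boundary E W \<inter> P \<and> in_boundary E W \<inter> P = in_boundary E W"
    if opt: "optimal A D T B C" and W: "associated_set A D T B C W" for B C W
  proof -
    obtain B' C' where Q: "Q B' C'"
      and sub: "B' \<subseteq> out_boundary E W \<inter> P" "C' \<subseteq> in_boundary E W \<inter> P"
      using improve[OF W] by blast
    have "\<not> card B' + card C' < card B + card C"
      using opt Q_feasible[OF Q] by (simp add: optimal_iff)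
    moreover have "B' \<subseteq> B" "C' \<subseteq> C" using a[OF W] sub by blast+
    ultimately have "B' = B" "C' = C"
      using subset_pair_eq_if_card_sum_ge[of B C B' C'] by simp_all
    then show ?thesis using sub a[OF W] by blast
  qed
  have c: "optimal A D T B C \<longleftrightarrow>
      is_arg_min (\<lambda>(B, C). card B + card C) (\<lambda>(B, C). Q B C) (B, C)" (is "_ \<longleftrightarrow> ?min") for B C
  proof
    assume opt: "optimal A D T B C"
    then have feas: "feasible A D T B C" by (simp add: optimal_iff)
    then obtain W where "associated_set A D T B C W" by (auto simp: feasible_def)
    with b[OF opt this] feas have "Q B C" unfolding Q_def feasible_def by blast
    then show ?min using opt Q_feasible by (auto simp: optimal_iff is_arg_min_def)
  next
    assume min: ?min
    then have "Q B C" by (simp add: is_arg_min_def)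
    moreover have "\<not> card B1 + card C1 < card B + card C" if feas: "feasible A D T B1 C1" for B1 C1
    proof -
      obtain W where W: "associated_set A D T B1 C1 W" using feas by (auto simp: feasible_def)
      obtain B' C' where Q: "Q B' C'" and "B' \<subseteq> B1" "C' \<subseteq> C1"
        using improve[OF W] a[OF W] by blast
      then have "card B' \<le> card B1" "card C' \<le> card C1" by (auto intro: card_mono)
      moreover have "\<not> card B' + card C' < card B + card C"
        using min Q by (auto simp: is_arg_min_def)
      ultimately show ?thesis by linarith
    qed
    ultimately show "optimal A D T B C" using Q_feasible by (simp add: optimal_iff)
  qed
  show ?thesis
    by (rule conjI[OF _ conjI]; intro allI impI; (elim conjE)?)
      (rule a b c[unfolded Q_def]; assumption)+
qed

end
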